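(* Let $u\colon\mathbb{R}^3\to\mathbb{O}$ have octonion Fourier transform $U$. Let $a,b,c\in\mathbb{R}\setminus\{0\}$, let $v\colon\mathbb{R}^3\to\mathbb{O}$ be defined by $v(x_1,x_2,x_3)=u\left(\frac{x_1}{a},\frac{x_2}{b},\frac{x_3}{c}\right)$, and let $V$ be the octonion Fourier transform of $v$. Then for all $(f_1,f_2,f_3)\in\mathbb{R}^3$ $$V(f_1,f_2,f_3)=|abc|\,U(af_1,bf_2,cf_3).$$
   Context: $\mathbb{O}$ denotes the real algebra of octonions with basis $1,\mathbf{e}_1,\dots,\mathbf{e}_7$: an octonion is a pair $(q_0,q_1)$ of quaternions (quaternion units $\mathbf{e}_1,\mathbf{e}_2,\mathbf{e}_3$ with $\mathbf{e}_1\mathbf{e}_2=\mathbf{e}_3$), with product $(q_0,q_1)\cdot(p_0,p_1)=(q_0p_0-p_1^*q_1,\;p_1q_0+q_1p_0^* )$, where $^*$ is quaternion conjugation, and $\mathbf{e}_4=(0,1)$, $\mathbf{e}_5=(0,\mathbf{e}_1)$, $\mathbf{e}_6=(0,\mathbf{e}_2)$, $\mathbf{e}_7=(0,\mathbf{e}_3)$. The product is neither commutative nor associative; products without brackets are evaluated from left to right, i.e. $abcd=((ab)c)d$. For an imaginary unit $\mathbf{e}_k$ and $\alpha\in\mathbb{R}$, $e^{\mathbf{e}_k\alpha}=\cos\alpha+\mathbf{e}_k\sin\alpha$. Integrals of octonion-valued functions are taken componentwise. The octonion Fourier transform (OFT) of a Lebesgue integrable $u\colon\mathbb{R}^3\to\mathbb{O}$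 is $$U(\mathbf{f})=\int_{\mathbb{R}^3}u(\mathbf{x})\,e^{-\mathbf{e}_1 2\pi f_1x_1}\,e^{-\mathbf{e}_2 2\pi f_2x_2}\,e^{-\mathbf{e}_4 2\pi f_3x_3}\,d\mathbf{x},\qquad \mathbf{f}=(f_1,f_2,f_3)\in\mathbb{R}^3,$$ with multiplication from left to right. Standing assumption: $u$ is Lebesgue integrable, so that its OFT is well defined. *)

theory Defs
  imports "HOL-Analysis.Analysis"
begin

text \<open>
  A quaternion is the tuple of its coordinates with respect to \<open>1, e1, e2, e3\<close>, and an octonion
  is a pair of quaternions. As iterated products of \<open>real\<close> both types are instances of
  \<^class>\<open>euclidean_space\<close>, so addition, real scaling and the Bochner integral are available
  and act componentwise, while no clashing multiplication is predefined on them.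
\<close>

type_synonym quaternion = "real \<times> real \<times> real \<times> real"

type_synonym octonion = "quaternion \<times> quaternion"

fun quat_mult :: "quaternion \<Rightarrow> quaternion \<Rightarrow> quaternion" (infixl "\<cdot>\<^sub>H" 70) where
  "(a0, a1, a2, a3) \<cdot>\<^sub>H (b0, b1, b2, b3) =
     (a0 * b0 - a1 * b1 - a2 * b2 - a3 * b3,
      a0 * b1 + a1 * b0 + a2 * b3 - a3 * b2,
      a0 * b2 - a1 * b3 + a2 * b0 + a3 * b1,
      a0 * b3 + a1 * b2 - a2 * b1 + a3 * b0)"

fun quat_cnj :: "quaternion \<Rightarrow> quaternion" where
  "quat_cnj (a0, a1, a2, a3) = (a0, - a1, - a2, - a3)"

fun octo_mult :: "octonion \<Rightarrow> octonion \<Rightarrow> octonion" (infixl "\<cdot>\<^sub>O" 70) where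
  "(q0, q1) \<cdot>\<^sub>O (p0, p1) =
     (q0 \<cdot>\<^sub>H p0 - quat_cnj p1 \<cdot>\<^sub>H q1, p1 \<cdot>\<^sub>H q0 + q1 \<cdot>\<^sub>H quat_cnj p0)"

definition octo_one :: octonion where "octo_one = ((1, 0, 0, 0), 0)"
definition octo_e1 :: octonion where "octo_e1 = ((0, 1, 0, 0), 0)"
definition octo_e2 :: octonion where "octo_e2 = ((0, 0, 1, 0), 0)"
definition octo_e4 :: octonion where "octo_e4 = (0, (1, 0, 0, 0))"

text \<open>\<open>octo_cis e \<alpha>\<close> is \<open>exp (e \<alpha>) = cos \<alpha> + e sin \<alpha>\<close> for an imaginary unit \<open>e\<close>.\<close>

definition octo_cis :: "octonion \<Rightarrow> real \<Rightarrow> octonion" where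
  "octo_cis e \<alpha> = cos \<alpha> *\<^sub>R octo_one + sin \<alpha> *\<^sub>R e"

text \<open>
  The octonion product is not associative; the integrand below is bracketed from the left, since
  \<open>\<cdot>\<^sub>O\<close> is declared left-associative.
\<close>

definition octonion_fourier :: "(real ^ 3 \<Rightarrow> octonion) \<Rightarrow> real ^ 3 \<Rightarrow> octonion" where
  "octonion_fourier u f =
     (LINT x|lebesgue.
        u x \<cdot>\<^sub>O octo_cis octo_e1 (- (2 * pi * f $ 1 * x $ 1))
            \<cdot>\<^sub>O octo_cis octo_e2 (- (2 * pi * f $ 2 * x $ 2))
            \<cdot>\<^sub>O octo_cis octo_e4 (- (2 * pi * f $ 3 * x $ 3)))"

end

theory Submission
  imports Defs
begin

text \<open>
  The substitution \<open>x = (a y1, b y2, c y3)\<close> turns the argument of \<open>u\<close> in the integral of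
  \<open>v\<close> back into \<open>y\<close>, and moves the factors \<open>a, b, c\<close> from the integration variable to the
  frequencies, since each phase depends only on the product of a frequency with the matching
  coordinate. The Jacobian of this diagonal map contributes \<open>\<bar>a b c\<bar>\<close>. The substitution acts
  on the integrand as a whole, so the octonion product enters only through its continuity, which
  makes the integrand measurable. The change of variables itself is
  \<open>integral_lebesgue_diagonal\<close>, which holds for any measurable function.
\<close>

text \<open>
  The Lebesgue measure is its own image under an invertible diagonal map, up to the density
  \<open>\<bar>\<Prod>i. c i\<bar>\<close>. For a function that is not integrable, its composition with the map is not integrable
  either, and both integrals take the default value \<open>0\<close>.
\<close>

lemma integral_lebesgue_diagonal:
  fixes f :: "real ^ 'n \<Rightarrow> 'b :: {banach, second_countable_topology}"
  assumes f: "f \<in> borel_measurable lebesgue" and c: "\<And>i. c i \<noteq> 0"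
  shows "(LINT x|lebesgue. f x) =
    \<bar>\<Prod>i\<in>UNIV. c i\<bar> *\<^sub>R (LINT x|lebesgue. f (\<chi> i. c i * x $ i))"
proof -
  \<comment> \<open>The inner product with \<open>\<chi> i. c i\<close> re-indexes the factors by basis vectors instead of
    coordinates.\<close>
  define C :: "real ^ 'n \<Rightarrow> real" where "C j = (\<chi> i. c i) \<bullet> j" for j
  define T :: "real ^ 'n \<Rightarrow> real ^ 'n"
    where "T x = 0 + (\<Sum>j\<in>Basis. (C j * (x \<bullet> j)) *\<^sub>R j)" for x
  have Basis: "(Basis :: (real ^ 'n) set) = range (\<lambda>i. axis i 1)"
    by (auto simp: Basis_vec_def)
  have inj: "inj (\<lambda>i. axis i 1 :: real ^ 'n)"
    by (auto simp: inj_on_def axis_eq_axis)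
  have T: "T x = (\<chi> i. c i * x $ i)" for x
  proof -
    have "T x = (\<Sum>i\<in>UNIV. (c i * x $ i) *\<^sub>R axis i 1)"
      by (simp add: T_def C_def Basis sum.reindex[OF inj] o_def inner_axis)
    then show ?thesis
      using basis_expansion[of "\<chi> i. c i * x $ i"] by (simp add: scalar_mult_eq_scaleR)
  qed
  have C: "(\<Prod>j\<in>Basis. \<bar>C j\<bar>) = \<bar>\<Prod>i\<in>UNIV. c i\<bar>"
    by (simp add: Basis prod.reindex[OF inj] o_def C_def inner_axis abs_prod)
  have nz: "C j \<noteq> 0" if "j \<in> Basis" for j
    using that c by (auto simp: Basis C_def inner_axis)
  have meas: "T \<in> lebesgue \<rightarrow>\<^sub>M lebesgue"
    unfolding T_def[abs_def] by (rule lebesgue_affine_measurable) (fact nz)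
  have leb: "lebesgue = density (distr lebesgue lebesgue T) (\<lambda>_. \<bar>\<Prod>i\<in>UNIV. c i\<bar>)"
    unfolding C[symmetric] T_def[abs_def] by (rule lebesgue_affine_euclidean) (fact nz)
  have "(LINT x|lebesgue. f x) =
      (LINT x|density (distr lebesgue lebesgue T) (\<lambda>_. \<bar>\<Prod>i\<in>UNIV. c i\<bar>). f x)"
    by (subst leb) (rule refl)
  also have "\<dots> = \<bar>\<Prod>i\<in>UNIV. c i\<bar> *\<^sub>R (LINT x|distr lebesgue lebesgue T. f x)"
    using f by (subst integral_density) auto
  also have "(LINT x|distr lebesgue lebesgue T. f x) = (LINT x|lebesgue. f (T x))"
    by (rule integral_distr[OF meas f])
  finally show ?thesis
    by (simp only: T)
qed

lemma octo_mult_fst_snd: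
  "x \<cdot>\<^sub>O y = (fst x \<cdot>\<^sub>H fst y - quat_cnj (snd y) \<cdot>\<^sub>H snd x,
            snd y \<cdot>\<^sub>H fst x + snd x \<cdot>\<^sub>H quat_cnj (fst y))"
  by (cases x; cases y) simp

lemma quat_mult_fst_snd:
  "p \<cdot>\<^sub>H q =
    (fst p * fst q - fst (snd p) * fst (snd q)
       - fst (snd (snd p)) * fst (snd (snd q)) - snd (snd (snd p)) * snd (snd (snd q)),
     fst p * fst (snd q) + fst (snd p) * fst q
       + fst (snd (snd p)) * snd (snd (snd q)) - snd (snd (snd p)) * fst (snd (snd q)),
     fst p * fst (snd (snd q)) - fst (snd p) * snd (snd (snd q))
       + fst (snd (snd p)) * fst q + snd (snd (snd p)) * fst (snd q),
     fst p * snd (snd (snd q)) + fst (snd p) * fst (snd (snd q))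
       - fst (snd (snd p)) * fst (snd q) + snd (snd (snd p)) * fst q)"
  by (cases p; cases q) simp

lemma quat_cnj_fst_snd:
  "quat_cnj q = (fst q, - fst (snd q), - fst (snd (snd q)), - snd (snd (snd q)))"
  by (cases q) simp

lemma continuous_on_quat_mult [continuous_intros]:
  "continuous_on S f \<Longrightarrow> continuous_on S g \<Longrightarrow> continuous_on S (\<lambda>x. f x \<cdot>\<^sub>H g x)"
  unfolding quat_mult_fst_snd by (intro continuous_intros)

lemma continuous_on_quat_cnj [continuous_intros]:
  "continuous_on S f \<Longrightarrow> continuous_on S (\<lambda>x. quat_cnj (f x))"
  unfolding quat_cnj_fst_snd by (intro continuous_intros)

lemma continuous_on_octo_mult [continuous_intros]:
  "continuous_on S f \<Longrightarrow> continuous_on S g \<Longrightarrow> continuous_on S (\<lambda>x. f x \<cdot>\<^sub>O g x)"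
  unfolding octo_mult_fst_snd by (intro continuous_intros)

lemma borel_measurable_octo_mult [measurable (raw)]:
  assumes "f \<in> borel_measurable M" "g \<in> borel_measurable M"
  shows "(\<lambda>x. f x \<cdot>\<^sub>O g x) \<in> borel_measurable M"
  by (rule borel_measurable_continuous_Pair[OF assms]) (intro continuous_intros)

lemma borel_measurable_octo_cis [measurable (raw)]:
  assumes "g \<in> borel_measurable M"
  shows "(\<lambda>x. octo_cis e (g x)) \<in> borel_measurable M"
  unfolding octo_cis_def using assms by measurable

lemma borel_measurable_lebesgue_component [measurable]:
  "(\<lambda>x :: real ^ 'n. x $ i) \<in> borel_measurable lebesgue"
  by (intro measurable_completion) simp

theorem theorem9:
  fixes u v :: "real ^ 3 \<Rightarrow> octonion" and U V :: "real ^ 3 \<Rightarrow> octonion" and a b c :: real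
  assumes "integrable lebesgue u"
    and "U = octonion_fourier u"
    and "a \<noteq> 0" and "b \<noteq> 0" and "c \<noteq> 0"
    and "\<And>x1 x2 x3. v (vector [x1, x2, x3]) = u (vector [x1 / a, x2 / b, x3 / c])"
    and "V = octonion_fourier v"
  shows "\<forall>f1 f2 f3. V (vector [f1, f2, f3]) = \<bar>a * b * c\<bar> *\<^sub>R U (vector [a * f1, b * f2, c * f3])"
proof (intro allI)
  fix f1 f2 f3 :: real
  define s :: "real ^ 3" where "s = vector [a, b, c]"
  \<comment> \<open>The integrand of \<open>U\<close> at the scaled frequency; the integrand of \<open>V\<close> is \<open>G\<close> after the substitution
    with the reciprocal factors \<open>1/a, 1/b, 1/c\<close>.\<close>
  define G where "G x = u x \<cdot>\<^sub>O octo_cis octo_e1 (- (2 * pi * (a * f1) * x $ 1))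
      \<cdot>\<^sub>O octo_cis octo_e2 (- (2 * pi * (b * f2) * x $ 2))
      \<cdot>\<^sub>O octo_cis octo_e4 (- (2 * pi * (c * f3) * x $ 3))" for x :: "real ^ 3"
  have u: "u \<in> borel_measurable lebesgue"
    using assms(1) by (rule borel_measurable_integrable)
  have G: "G \<in> borel_measurable lebesgue"
    unfolding G_def[abs_def]
    by (intro borel_measurable_octo_mult borel_measurable_octo_cis borel_measurable_uminus
        borel_measurable_times borel_measurable_const borel_measurable_lebesgue_component u)
  have nz: "1 / s $ i \<noteq> 0" for i
    using assms(3-5) exhaust_3[of i] by (auto simp: s_def)
  have v: "v x = u (\<chi> i. 1 / s $ i * x $ i)" for x
  proof -
    have "x = vector [x $ 1, x $ 2, x $ 3]"
      by (simp add: vec_eq_iff forall_3)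
    then have "v x = v (vector [x $ 1, x $ 2, x $ 3])"
      by (rule arg_cong)
    also have "\<dots> = u (vector [x $ 1 / a, x $ 2 / b, x $ 3 / c])"
      by (rule assms(6))
    also have "vector [x $ 1 / a, x $ 2 / b, x $ 3 / c] = (\<chi> i. 1 / s $ i * x $ i)"
      by (simp add: vec_eq_iff forall_3 s_def)
    finally show ?thesis .
  qed
  have phase: "2 * pi * (r * f) * (1 / r * y) = 2 * pi * f * y" if "r \<noteq> 0" for r f y :: real
    using that by simp
  have "V (vector [f1, f2, f3]) = (LINT x|lebesgue. G (\<chi> i. 1 / s $ i * x $ i))"
    unfolding assms(7) octonion_fourier_def G_def v
    by (simp only: s_def vector_3 vec_lambda_beta phase[OF assms(3)] phase[OF assms(4)]
        phase[OF assms(5)])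
  moreover have "U (vector [a * f1, b * f2, c * f3]) = (LINT x|lebesgue. G x)"
    by (simp add: assms(2) octonion_fourier_def G_def)
  moreover have "\<bar>\<Prod>i\<in>UNIV. 1 / s $ i\<bar> = 1 / \<bar>a * b * c\<bar>"
  proof -
    have "(\<Prod>i\<in>UNIV. 1 / s $ i) = 1 / a * (1 / b * (1 / c))"
      unfolding UNIV_3 by (simp add: s_def)
    also have "\<dots> = 1 / (a * b * c)"
      by simp
    finally show ?thesis
      by (simp only: abs_divide abs_one)
  qed
  moreover have "(LINT x|lebesgue. G x) =
      \<bar>\<Prod>i\<in>UNIV. 1 / s $ i\<bar> *\<^sub>R (LINT x|lebesgue. G (\<chi> i. 1 / s $ i * x $ i))"
    by (rule integral_lebesgue_diagonal[OF G nz])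
  ultimately have "U (vector [a * f1, b * f2, c * f3]) =
      (1 / \<bar>a * b * c\<bar>) *\<^sub>R V (vector [f1, f2, f3])"
    by (simp only:)
  then show "V (vector [f1, f2, f3]) = \<bar>a * b * c\<bar> *\<^sub>R U (vector [a * f1, b * f2, c * f3])"
    using assms(3-5) by simp
qed

end
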